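(* Let $n,s,k,l$ be integers with $k\ge 1$, $k\le l\le s-1$ and $s\le n$. Then $$p^{l+1}_{n;\le s;k}-p^{l}_{n;\le s;k}=\sum_{i=k-1}^{l-2}\binom{n-1}{i-k+1}\,p_{i-k+1,\,i;\le i}\Big[p^{\,l-i}_{n+k-i-1;\le s-i-1}-p^{\,l-i-1}_{n+k-i-1;\le s-i-1}\Big]+\binom{n-1}{l-k}\,p_{l-k,\,l-1;\le l-1}\Big[p^1_{n+k-l;\le s-l}-p^{\,s-l}_{n+k-l;\le s-l;1}\Big].$$
   Context: Parking model: there are $m$ parking spaces in a line, numbered $1,\dots,m$. A preference set of length $N$ is a sequence $(a_1,\dots,a_N)$ of integers with $1\le a_i\le m$; cars $1,\dots,N$ arrive in order, car $i$ parks in the first unoccupied space numbered $\ge a_i$ if one exists, otherwise it fails to park. A $k$-flaw preference set is one where exactly $k$ cars fail to park; a $0$-flaw one is a parking function. $p_{N,m;\le t;k}$ denotes the number of $k$-flaw preference sets of length $N$ with $m$ spaces and all entries $\le t$, and $p^r_{N,m;\le t;k}$ those with first entry $r$. Conventions: omitted $k$ means $k=0$; omitted $m$ means $m=N$. Thus $p^r_{N;\le t;k}$ counts $k$-flaw preference sets with $N$ cars, $N$ spaces, entries $\le t$ and first entry $r$; $p^r_{N;\le t}$ counts such parking functions; $p_{j,m;\le t}$ counts parking functions of length $j$ with $m$ spaces and entries $\le t$ (the empty sequence counts, so $p_{0,m;\le t}=1$). *)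

theory Defs
  imports Complex_Main
begin

definition free_spaces :: "nat \<Rightarrow> nat set \<Rightarrow> nat \<Rightarrow> nat set" where
  "free_spaces m occ a = {j. a \<le> j \<and> j \<le> m \<and> j \<notin> occ}"

text \<open>\<open>failures m occ as\<close> is the number of cars that fail to park when cars with preferences
  \<open>as\<close> arrive in this order and the spaces in \<open>occ\<close> are already taken.\<close>

primrec failures :: "nat \<Rightarrow> nat set \<Rightarrow> nat list \<Rightarrow> nat" where
  "failures m occ [] = 0"
| "failures m occ (a # as) =
     (if free_spaces m occ a = {} then Suc (failures m occ as)
      else failures m (insert (LEAST j. j \<in> free_spaces m occ a) occ) as)"

definition preference_sets :: "nat \<Rightarrow> nat \<Rightarrow> nat list set" where
  "preference_sets N m = {as. length as = N \<and> set as \<subseteq> {1..m}}"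

definition flaw_sets :: "nat \<Rightarrow> nat \<Rightarrow> nat \<Rightarrow> nat \<Rightarrow> nat list set" where
  "flaw_sets N m t k =
     {as \<in> preference_sets N m. (\<forall>a \<in> set as. a \<le> t) \<and> failures m {} as = k}"

text \<open>\<open>num_flaw N m t k\<close> is $p_{N,m;\le t;k}$ and \<open>num_flaw_first r N m t k\<close> is
  $p^r_{N,m;\le t;k}$.\<close>

definition num_flaw :: "nat \<Rightarrow> nat \<Rightarrow> nat \<Rightarrow> nat \<Rightarrow> nat" where
  "num_flaw N m t k = card (flaw_sets N m t k)"

definition num_flaw_first :: "nat \<Rightarrow> nat \<Rightarrow> nat \<Rightarrow> nat \<Rightarrow> nat \<Rightarrow> nat" where
  "num_flaw_first r N m t k = card {as \<in> flaw_sets N m t k. as \<noteq> [] \<and> hd as = r}"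

end

theory Submission
  imports Defs
begin

text \<open>
  Write \<open>C j\<close> for the number of preferences \<open>\<le> j\<close>. With \<open>n\<close> cars and \<open>n\<close> spaces the number of
  failing cars is the maximum over \<open>j \<le> n\<close> of \<open>j - C j\<close>. Changing the first preference from
  \<open>l\<close> to \<open>l + 1\<close> only raises \<open>j - C j\<close> at \<open>j = l\<close>, by one, so it changes the number of failures
  (from \<open>k\<close> to \<open>k + 1\<close>, say) exactly when afterwards \<open>l\<close> is the only maximiser. Let \<open>T k\<close> be the
  number of such tails; the left-hand side is \<open>T (k - 1) - T k\<close>. Separating the entries
  \<open>\<le> l\<close> from those \<open>> l\<close> writes \<open>T k\<close> as a binomial coefficient times two counts of parking
  functions. \<open>T (k - 1)\<close> is the last summand of the claim. Splitting the left factor of \<open>T k\<close> at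
  the first maximiser of \<open>j - C j\<close> gives a convolution whose summands are the differences for
  parking functions (again by the formula for \<open>T\<close>), which is the sum over \<open>i\<close>.
\<close>

section \<open>Counting entries and the ballot condition\<close>

definition cnt :: "nat list \<Rightarrow> nat \<Rightarrow> nat" where
  "cnt as j = length (filter (\<lambda>a. a \<le> j) as)"

definition words :: "nat \<Rightarrow> nat \<Rightarrow> nat list set" where
  "words N t = {as. length as = N \<and> set as \<subseteq> {1..t}}"

text \<open>\<open>d\<close> bounds the deficit \<open>j - cnt as j\<close>. It is the number of
  empty spaces when parking functions are counted, and the bound on the failures when there are as
  many cars as spaces.\<close>

definition ballot :: "nat \<Rightarrow> nat \<Rightarrow> nat list \<Rightarrow> bool" where
  "ballot m d as \<longleftrightarrow> (\<forall>j\<le>m. j \<le> cnt as j + d)"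

lemma cnt_Nil [simp]: "cnt [] j = 0"
  by (simp add: cnt_def)

lemma cnt_Cons [simp]: "cnt (a # as) j = (if a \<le> j then 1 else 0) + cnt as j"
  by (simp add: cnt_def)

lemma cnt_le_length: "cnt as j \<le> length as"
  by (simp add: cnt_def)

lemma cnt_eq_length: "set as \<subseteq> {1..t} \<Longrightarrow> t \<le> j \<Longrightarrow> cnt as j = length as"
  unfolding cnt_def by (subst filter_True) auto

lemma cnt_mono: "i \<le> j \<Longrightarrow> cnt as i \<le> cnt as j"
  by (induction as) auto

lemma finite_words [simp]: "finite (words N t)"
  unfolding words_def using finite_lists_length_eq[of "{1..t}" N] by (simp add: conj_commute)

section \<open>Failures as a ballot condition\<close>

lemma card_occ_insert:
  fixes occ :: "nat set"
  assumes "p \<notin> occ" "p \<le> m"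
  shows "card (insert p occ \<inter> {j<..m}) = card (occ \<inter> {j<..m}) + (if j < p then 1 else 0)"
  using assms by (auto simp: Int_insert_left)

lemma card_occ_block:
  fixes occ :: "nat set"
  assumes "{i<..j} \<subseteq> occ" "i \<le> j" "j \<le> m"
  shows "card (occ \<inter> {i<..m}) = card (occ \<inter> {j<..m}) + (j - i)"
proof -
  have "occ \<inter> {i<..m} = (occ \<inter> {j<..m}) \<union> {i<..j}"
    using assms by auto
  moreover have "card ((occ \<inter> {j<..m}) \<union> {i<..j}) = card (occ \<inter> {j<..m}) + card {i<..j}"
    by (rule card_Un_disjoint) auto
  ultimately show ?thesis by simp
qed

text \<open>Cars preferring a space beyond \<open>j\<close>, together with the spaces already taken
  there, compete for \<open>m - j\<close> places; the number of failures is the largest excess over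
  all \<open>j\<close>. Keeping \<open>occ\<close> arbitrary lets the induction follow the
  arrivals.\<close>

lemma failures_le_iff_occ:
  assumes "set as \<subseteq> {1..m}"
  shows "failures m occ as \<le> k \<longleftrightarrow>
    (\<forall>j\<le>m. length as + card (occ \<inter> {j<..m}) + j \<le> cnt as j + m + k)"
  using assms
proof (induction as arbitrary: occ k)
  case Nil
  have "card (occ \<inter> {j<..m}) + j \<le> m + k" if "j \<le> m" for j
    using card_mono[of "{j<..m}" "occ \<inter> {j<..m}"] that by simp
  then show ?case by simp
next
  case (Cons a as)
  have a: "1 \<le> a" "a \<le> m" and as: "set as \<subseteq> {1..m}"
    using Cons.prems by auto
  let ?c = "\<lambda>j. card (occ \<inter> {j<..m})"
  show ?case
  proof (cases "free_spaces m occ a = {}")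
    case True
    then have full: "{a - 1<..j} \<subseteq> occ" if "j \<le> m" for j
      using that by (auto simp: free_spaces_def)
    \<comment> \<open>\<open>?c j + j\<close> is constant along the full block, so the inequality at
      \<open>a - 1\<close> will control every \<open>j\<close> in it.\<close>
    have tight: "?c (a - 1) = ?c j + (j - (a - 1))" if "a - 1 \<le> j" "j \<le> m" for j
      using card_occ_block[OF full that] that by blast
    have cm: "?c m = 0" by simp
    have L: "failures m occ (a # as) \<le> k \<longleftrightarrow> 1 \<le> k \<and> 
        (\<forall>j\<le>m. length as + ?c j + j \<le> cnt as j + m + (k - 1))"
      using True Cons.IH[OF as, of occ "k - 1"] by (cases k) auto
    show ?thesis
    proof
      assume "failures m occ (a # as) \<le> k"
      with L have k: "1 \<le> k" and *: "\<And>j. j \<le> m \<Longrightarrow> length as + ?c j + j \<le> cnt as j + m + (k - 1)"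
        by auto
      show "\<forall>j\<le>m. length (a # as) + ?c j + j \<le> cnt (a # as) j + m + k"
      proof (intro allI impI)
        fix j assume "j \<le> m"
        from *[OF this] k show "length (a # as) + ?c j + j \<le> cnt (a # as) j + m + k"
          by simp
      qed
    next
      assume R: "\<forall>j\<le>m. length (a # as) + ?c j + j \<le> cnt (a # as) j + m + k"
      \<comment> \<open>At \<open>a - 1\<close> the arriving car is counted in the length but not in
        \<open>cnt\<close>; this is where the extra 1 comes from.\<close>
      have r: "1 + length as + ?c (a - 1) + (a - 1) \<le> cnt as (a - 1) + m + k"
        using spec[OF R, of "a - 1"] a by (auto split: if_splits)
      have cle: "cnt as (a - 1) \<le> length as" by (rule cnt_le_length)
      \<comment> \<open>Carrying \<open>r\<close> along the block to \<open>j = m\<close> leaves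
        only the failing car against \<open>k\<close>.\<close>
      have k: "1 \<le> k"
        using r cle tight[of m] cm a by simp
      have "length as + ?c j + j \<le> cnt as j + m + (k - 1)" if j: "j \<le> m" for j
      proof (cases "j < a")
        case True
        then show ?thesis using R[rule_format, OF j] k by simp
      next
        case False
        then show ?thesis
          using r tight[of j] cnt_mono[of "a - 1" j as] k j by linarith
      qed
      with L k show "failures m occ (a # as) \<le> k" by blast
    qed
  next
    case False
    define p where "p = (LEAST j. j \<in> free_spaces m occ a)"
    have "p \<in> free_spaces m occ a"
      using False unfolding p_def by (metis LeastI all_not_in_conv)
    then have p: "a \<le> p" "p \<le> m" "p \<notin> occ"
      by (auto simp: free_spaces_def)
    have full: "{a - 1<..j} \<subseteq> occ" if "j < p" for j
    proof
      fix x assume x: "x \<in> {a - 1<..j}"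
      then have "x \<notin> free_spaces m occ a"
        using that not_less_Least[of x "\<lambda>j. j \<in> free_spaces m occ a"] unfolding p_def by auto
      then show "x \<in> occ"
        using x that p by (auto simp: free_spaces_def)
    qed
    have tight: "?c (a - 1) = ?c j + (j - (a - 1))" if "a \<le> j" "j < p" for j
      using card_occ_block[OF full[OF that(2)]] that p by auto
    have c': "card (insert p occ \<inter> {j<..m}) = ?c j + (if j < p then 1 else 0)" for j
      using card_occ_insert p by blast
    have L: "failures m occ (a # as) \<le> k \<longleftrightarrow>
        (\<forall>j\<le>m. length as + (?c j + (if j < p then 1 else 0)) + j \<le> cnt as j + m + k)"
      using False Cons.IH[OF as, of "insert p occ" k] by (simp add: p_def[symmetric] c')
    show ?thesis
    proof
      assume "failures m occ (a # as) \<le> k"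
      with L have *: "\<And>j. j \<le> m \<Longrightarrow>
          length as + (?c j + (if j < p then 1 else 0)) + j \<le> cnt as j + m + k"
        by blast
      show "\<forall>j\<le>m. length (a # as) + ?c j + j \<le> cnt (a # as) j + m + k"
      proof (intro allI impI)
        fix j assume "j \<le> m"
        from *[OF this] p show "length (a # as) + ?c j + j \<le> cnt (a # as) j + m + k"
          by (auto split: if_splits)
      qed
    next
      assume R: "\<forall>j\<le>m. length (a # as) + ?c j + j \<le> cnt (a # as) j + m + k"
      have r: "1 + length as + ?c (a - 1) + (a - 1) \<le> cnt as (a - 1) + m + k"
        using spec[OF R, of "a - 1"] a by (auto split: if_splits)
      have "length as + (?c j + (if j < p then 1 else 0)) + j \<le> cnt as j + m + k"
        if j: "j \<le> m" for j
      \<comment> \<open>The two systems of inequalities differ only between \<open>a\<close> and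
        \<open>p\<close>: below \<open>a\<close> both charge 1, and from \<open>p\<close> on the new
        car enters length and \<open>cnt\<close> alike. In between all spaces are taken, so
        \<open>r\<close> carries over.\<close>
      proof (cases "a \<le> j \<and> j < p")
        case True
        then have "cnt as (a - 1) \<le> cnt as j"
          by (intro cnt_mono) linarith
        with True show ?thesis
          using r tight[of j] by auto
      next
        case False
        then show ?thesis using R[rule_format, OF j] p by auto
      qed
      with L show "failures m occ (a # as) \<le> k" by blast
    qed
  qed
qed

lemma failures_le_iff_ballot:
  assumes "set as \<subseteq> {1..m}" and "length as + d = m + k"
  shows "failures m {} as \<le> k \<longleftrightarrow> ballot m d as"
  unfolding failures_le_iff_occ[OF assms(1)] ballot_def using assms(2) by auto

lemma num_flaw_0:
  assumes "t \<le> m" and "N + d = m"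
  shows "num_flaw N m t 0 = card {as \<in> words N t. ballot m d as}"
proof -
  have "flaw_sets N m t 0 = {as \<in> words N t. ballot m d as}"
    using assms failures_le_iff_ballot[where m = m and d = d and k = 0]
    by (fastforce simp: flaw_sets_def preference_sets_def words_def)
  then show ?thesis by (simp add: num_flaw_def)
qed

section \<open>Tails behind a fixed first preference\<close>

definition ballot_tails :: "nat \<Rightarrow> nat \<Rightarrow> nat \<Rightarrow> nat \<Rightarrow> nat list set" where
  "ballot_tails n s r k = {b \<in> words (n - 1) s. ballot n k (r # b)}"

lemma finite_ballot_tails [simp]: "finite (ballot_tails n s r k)"
  by (simp add: ballot_tails_def)

lemma ballot_tails_mono: "k \<le> k' \<Longrightarrow> ballot_tails n s r k \<subseteq> ballot_tails n s r k'"
  by (fastforce simp: ballot_tails_def ballot_def)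

lemma num_flaw_first_eq_card_tails:
  assumes "1 \<le> r" "r \<le> s" "s \<le> n"
  shows "num_flaw_first r n n s k =
    card {b \<in> words (n - 1) s. failures n {} (r # b) = k}"
proof -
  have "{as \<in> flaw_sets n n s k. as \<noteq> [] \<and> hd as = r} =
      (#) r ` {b \<in> words (n - 1) s. failures n {} (r # b) = k}" (is "?A = ?B")
  proof (intro equalityI subsetI)
    fix as assume as: "as \<in> ?A"
    then obtain b where b: "as = r # b" by (cases as) auto
    with as have "b \<in> {b \<in> words (n - 1) s. failures n {} (r # b) = k}"
      by (auto simp: flaw_sets_def preference_sets_def words_def simp del: failures.simps)
    with b show "as \<in> ?B" by blast
  next
    fix as assume "as \<in> ?B"
    then obtain b where b: "as = r # b" "b \<in> words (n - 1) s" "failures n {} (r # b) = k"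
      by blast
    then show "as \<in> ?A"
      using assms by (fastforce simp: flaw_sets_def preference_sets_def words_def simp del: failures.simps)
  qed
  then show ?thesis
    by (simp add: num_flaw_first_def card_image del: failures.simps)
qed

text \<open>Removing the first entry places the tails for different first preferences in one set of
  words, where they can be compared by inclusion.\<close>

lemma failures_Cons_le_iff:
  assumes "1 \<le> r" "r \<le> s" "s \<le> n" "b \<in> words (n - 1) s"
  shows "failures n {} (r # b) \<le> k \<longleftrightarrow> b \<in> ballot_tails n s r k"
  using assms failures_le_iff_ballot[of "r # b" n k k]
  by (fastforce simp: ballot_tails_def words_def simp del: failures.simps)

lemma num_flaw_first_0:
  assumes "1 \<le> r" "r \<le> s" "s \<le> n"
  shows "num_flaw_first r n n s 0 = card (ballot_tails n s r 0)"
proof -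
  have "{b \<in> words (n - 1) s. failures n {} (r # b) = 0} = ballot_tails n s r 0"
    using failures_Cons_le_iff[OF assms, of _ 0]
    by (auto simp: ballot_tails_def simp del: failures.simps)
  then show ?thesis by (simp only: num_flaw_first_eq_card_tails[OF assms])
qed

lemma num_flaw_first_Suc:
  assumes "1 \<le> r" "r \<le> s" "s \<le> n"
  shows "int (num_flaw_first r n n s (Suc k)) =
    int (card (ballot_tails n s r (Suc k))) - int (card (ballot_tails n s r k))"
proof -
  have "{b \<in> words (n - 1) s. failures n {} (r # b) = Suc k} =
      ballot_tails n s r (Suc k) - ballot_tails n s r k"
  proof (rule set_eqI)
    fix b
    have "failures n {} (r # b) = Suc k \<longleftrightarrow>
        failures n {} (r # b) \<le> Suc k \<and> \<not> failures n {} (r # b) \<le> k"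
      by linarith
    then show "b \<in> {b \<in> words (n - 1) s. failures n {} (r # b) = Suc k} \<longleftrightarrow>
        b \<in> ballot_tails n s r (Suc k) - ballot_tails n s r k"
      using failures_Cons_le_iff[OF assms, of b k] failures_Cons_le_iff[OF assms, of b "Suc k"]
      by (auto simp: ballot_tails_def simp del: failures.simps)
  qed
  then have "num_flaw_first r n n s (Suc k) =
      card (ballot_tails n s r (Suc k)) - card (ballot_tails n s r k)"
    by (simp only: num_flaw_first_eq_card_tails[OF assms])
      (simp add: card_Diff_subset ballot_tails_mono)
  then show ?thesis
    using card_mono[OF _ ballot_tails_mono[of k "Suc k"]] by (simp add: of_nat_diff)
qed

text \<open>The bound beyond \<open>l\<close> is weaker by one because the removed first entry,
  \<open>l\<close> or \<open>Suc l\<close>, adds 1 to the counts there. With no entry removed, the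
  same conditions say that \<open>l\<close> is the first index attaining the maximal deficit
  \<open>Suc k\<close>.\<close>

definition first_tight :: "nat \<Rightarrow> nat \<Rightarrow> nat \<Rightarrow> nat \<Rightarrow> nat \<Rightarrow> nat list set" where
  "first_tight N s n l k = {b \<in> words N s. cnt b l + Suc k = l \<and>
     (\<forall>j<l. j \<le> cnt b j + k) \<and> (\<forall>j. l < j \<and> j \<le> n \<longrightarrow> j \<le> cnt b j + Suc k)}"

lemma card_ballot_tails_diff:
  assumes "1 \<le> l" "l \<le> n"
  shows "int (card (ballot_tails n s (Suc l) k)) - int (card (ballot_tails n s l k)) =
    - int (card (first_tight (n - 1) s n l k))"
proof -
  have sub: "ballot_tails n s (Suc l) k \<subseteq> ballot_tails n s l k"
  proof
    fix b assume b: "b \<in> ballot_tails n s (Suc l) k"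
    have "cnt (Suc l # b) j \<le> cnt (l # b) j" for j by simp
    with b show "b \<in> ballot_tails n s l k"
      unfolding ballot_tails_def ballot_def mem_Collect_eq
      by (meson add_le_mono1 order_trans)
  qed
  have "first_tight (n - 1) s n l k = ballot_tails n s l k - ballot_tails n s (Suc l) k"
    (is "?A = ?B")
  proof (intro equalityI subsetI)
    fix b assume b: "b \<in> ?A"
    have "j \<le> cnt (l # b) j + k" if "j \<le> n" for j
    proof -
      consider "j < l" | "j = l" | "l < j" by linarith
      then show ?thesis
        by cases (use b that in \<open>auto simp: first_tight_def\<close>)
    qed
    then have "ballot n k (l # b)"
      by (simp add: ballot_def)
    moreover have "\<not> ballot n k (Suc l # b)"
      using b assms by (auto simp: first_tight_def ballot_def intro!: exI[of _ l])
    ultimately show "b \<in> ?B"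
      using b by (auto simp: first_tight_def ballot_tails_def)
  next
    fix b assume b: "b \<in> ?B"
    then have w: "b \<in> words (n - 1) s" and 1: "ballot n k (l # b)" and 2: "\<not> ballot n k (Suc l # b)"
      by (auto simp: ballot_tails_def)
    have le: "j \<le> (if l \<le> j then 1 else 0) + cnt b j + k" if "j \<le> n" for j
      using 1 that by (auto simp: ballot_def)
    obtain i where i: "i \<le> n" "(if Suc l \<le> i then 1 else 0) + cnt b i + k < i"
      using 2 by (auto simp: ballot_def not_le)
    \<comment> \<open>The counts for first entries \<open>l\<close> and \<open>Suc l\<close> agree
      at every other index, where \<open>le\<close> excludes a violation.\<close>
    then have "i = l"
      using le[of i] by (auto split: if_splits)
    then have "cnt b l + Suc k = l"
      using i le[of l] by auto
    moreover have "j \<le> cnt b j + k" if "j < l" for j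
      using le[of j] that assms by auto
    moreover have "j \<le> cnt b j + Suc k" if "l < j" "j \<le> n" for j
      using le[of j] that by auto
    ultimately show "b \<in> ?A"
      using w by (auto simp: first_tight_def)
  qed
  then have "card (first_tight (n - 1) s n l k) =
      card (ballot_tails n s l k) - card (ballot_tails n s (Suc l) k)"
    by (simp add: card_Diff_subset sub)
  then show ?thesis
    using card_mono[OF _ sub] by (simp add: of_nat_diff)
qed

section \<open>Splitting words into low and high entries\<close>

lemma cnt_filter_low:
  "j \<le> l \<Longrightarrow> cnt (filter (\<lambda>x. x \<le> l) b) j = cnt b j"
  by (induction b) auto

lemma cnt_split_high:
  "l \<le> j \<Longrightarrow> cnt b j = cnt b l + cnt (map (\<lambda>x. x - l) (filter (\<lambda>x. \<not> x \<le> l) b)) (j - l)"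
  by (induction b) auto

text \<open>A word is a shuffle of its low entries with its high ones, the latter shifted down by
  \<open>l\<close>. Filtering recovers both parts, so the shuffle sets of distinct pairs are
  disjoint, and each has \<open>N choose a\<close> elements.\<close>

lemma card_words_split:
  assumes "l \<le> s" and "a \<le> N"
  shows "card {b \<in> words N s. cnt b l = a \<and> P (filter (\<lambda>x. x \<le> l) b) \<and>
            Q (map (\<lambda>x. x - l) (filter (\<lambda>x. \<not> x \<le> l) b))} =
    (N choose a) * card {x \<in> words a l. P x} * card {y \<in> words (N - a) (s - l). Q y}"
proof -
  define X where "X = {x \<in> words a l. P x}"
  define Y where "Y = {y \<in> words (N - a) (s - l). Q y}"
  define sh where "sh = (\<lambda>(x, y). shuffles x (map ((+) l) y))"
  have fin: "finite X" "finite Y"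
    by (simp_all add: X_def Y_def)
  have X: "length x = a" "set x \<subseteq> {1..l}" "P x" if "x \<in> X" for x
    using that by (auto simp: X_def words_def)
  have Y: "length y = N - a" "set y \<subseteq> {1..s - l}" "Q y" if "y \<in> Y" for y
    using that by (auto simp: Y_def words_def)
  have low: "filter (\<lambda>z. z \<le> l) b = x"
    and high: "map (\<lambda>z. z - l) (filter (\<lambda>z. \<not> z \<le> l) b) = y"
    if "x \<in> X" "y \<in> Y" "b \<in> sh (x, y)" for x y b
  proof -
    have x1: "filter (\<lambda>z. z \<le> l) x = x" and x2: "filter (\<lambda>z. \<not> z \<le> l) x = []"
      using X(2)[OF that(1)] by (auto simp: filter_id_conv filter_empty_conv)
    have y1: "filter (\<lambda>z. z \<le> l) (map ((+) l) y) = []"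
      and y2: "filter (\<lambda>z. \<not> z \<le> l) (map ((+) l) y) = map ((+) l) y"
      using Y(2)[OF that(2)] by (auto simp: filter_id_conv filter_empty_conv)
    have "filter (\<lambda>z. z \<le> l) b \<in> shuffles x []"
      using that(3) filter_shuffles[of "\<lambda>z. z \<le> l" x "map ((+) l) y"] x1 y1
      by (auto simp: sh_def)
    then show "filter (\<lambda>z. z \<le> l) b = x" by simp
    have "filter (\<lambda>z. \<not> z \<le> l) b \<in> shuffles [] (map ((+) l) y)"
      using that(3) filter_shuffles[of "\<lambda>z. \<not> z \<le> l" x "map ((+) l) y"] x2 y2
      by (auto simp: sh_def)
    then show "map (\<lambda>z. z - l) (filter (\<lambda>z. \<not> z \<le> l) b) = y"
      by (simp add: comp_def)
  qed
  have "{b \<in> words N s. cnt b l = a \<and> P (filter (\<lambda>x. x \<le> l) b) \<and>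
            Q (map (\<lambda>x. x - l) (filter (\<lambda>x. \<not> x \<le> l) b))} = (\<Union>p\<in>X \<times> Y. sh p)"
    (is "?A = ?B")
  proof (intro equalityI subsetI)
    fix b assume b: "b \<in> ?A"
    define x where "x = filter (\<lambda>x. x \<le> l) b"
    define y where "y = map (\<lambda>x. x - l) (filter (\<lambda>x. \<not> x \<le> l) b)"
    have "length x = a"
      using b by (simp add: x_def cnt_def)
    then have "x \<in> X"
      using b by (auto simp: X_def words_def x_def)
    moreover have "length y = N - a"
      using b sum_length_filter_compl[of "\<lambda>x. x \<le> l" b] \<open>length x = a\<close>
      by (auto simp: x_def y_def words_def)
    then have "y \<in> Y"
      using b by (fastforce simp: Y_def words_def y_def)
    moreover have "map ((+) l) y = filter (\<lambda>x. \<not> x \<le> l) b"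
      unfolding y_def map_map by (rule map_idI) auto
    then have "b \<in> sh (x, y)"
      using partition_in_shuffles[of b "\<lambda>x. x \<le> l"] by (simp add: sh_def x_def)
    ultimately show "b \<in> ?B" by blast
  next
    fix b assume "b \<in> ?B"
    then obtain x y where xy: "x \<in> X" "y \<in> Y" "b \<in> sh (x, y)" by auto
    have "length b = length x + length y" "set b = set x \<union> (+) l ` set y"
      using xy(3) length_shuffles[of b x] set_shuffles[of b x] by (auto simp: sh_def)
    then have "length b = N" "set b \<subseteq> {1..s}"
      using X(1,2)[OF xy(1)] Y(1,2)[OF xy(2)] assms by fastforce+
    then show "b \<in> ?A"
      using low[OF xy] high[OF xy] X[OF xy(1)] Y[OF xy(2)] by (simp add: words_def cnt_def)
  qed
  also have "card \<dots> = (\<Sum>p\<in>X \<times> Y. card (sh p))"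
  proof (rule card_UN_disjoint)
    show "\<forall>p\<in>X \<times> Y. \<forall>q\<in>X \<times> Y. p \<noteq> q \<longrightarrow> sh p \<inter> sh q = {}"
      using low high by (auto simp: disjoint_iff) metis+
  qed (use fin in \<open>auto simp: sh_def\<close>)
  also have "\<dots> = (\<Sum>p\<in>X \<times> Y. N choose a)"
  proof (rule sum.cong[OF refl])
    fix p assume "p \<in> X \<times> Y"
    then obtain x y where p: "p = (x, y)" "x \<in> X" "y \<in> Y" by auto
    have "set x \<inter> set (map ((+) l) y) = {}"
      using X(2)[OF p(2)] Y(2)[OF p(3)] by fastforce
    then show "card (sh p) = (N choose a)"
      using card_disjoint_shuffles[of x "map ((+) l) y"] X(1)[OF p(2)] Y(1)[OF p(3)] assms p(1) by (simp add: sh_def)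
  qed
  also have "\<dots> = (N choose a) * card X * card Y"
    by (simp add: card_cartesian_product)
  finally show ?thesis by (simp add: X_def Y_def)
qed

text \<open>Exactly \<open>a\<close> entries are at most \<open>l = Suc (a + k)\<close>. As the
  deficit at \<open>l\<close> already is \<open>Suc k\<close>, the high part may add none, which is
  the ballot condition with slack 0.\<close>

lemma card_first_tight:
  assumes "Suc (a + k) \<le> s" and "a \<le> N"
  shows "card (first_tight N s n (Suc (a + k)) k) =
    (N choose a) * num_flaw a (a + k) (a + k) 0 *
    card {y \<in> words (N - a) (s - Suc (a + k)). ballot (n - Suc (a + k)) 0 y}"
proof -
  define l where "l = Suc (a + k)"
  define P where "P x \<longleftrightarrow> (\<forall>j<l. j \<le> cnt x j + k)" for x
  have high: "(\<forall>j. l < j \<and> j \<le> n \<longrightarrow> j \<le> cnt b j + Suc k) \<longleftrightarrow>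
      ballot (n - l) 0 (map (\<lambda>x. x - l) (filter (\<lambda>x. \<not> x \<le> l) b))" (is "?L \<longleftrightarrow> ballot _ _ ?c")
    if "cnt b l = a" for b
  proof
    assume L: ?L
    have "i \<le> cnt ?c i" if "i \<le> n - l" for i
      using L[rule_format, of "l + i"] that \<open>cnt b l = a\<close> cnt_split_high[of l "l + i" b]
      by (cases "i = 0") (auto simp: l_def)
    then show "ballot (n - l) 0 ?c" by (simp add: ballot_def)
  next
    assume R: "ballot (n - l) 0 ?c"
    show ?L
    proof (intro allI impI)
      fix j assume j: "l < j \<and> j \<le> n"
      then have "j - l \<le> cnt ?c (j - l)"
        using R diff_le_mono[of j n l] unfolding ballot_def by simp
      then show "j \<le> cnt b j + Suc k"
        using j that cnt_split_high[of l j b] by (simp add: l_def)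
    qed
  qed
  have "first_tight N s n l k = {b \<in> words N s. cnt b l = a \<and> P (filter (\<lambda>x. x \<le> l) b) \<and>
      ballot (n - l) 0 (map (\<lambda>x. x - l) (filter (\<lambda>x. \<not> x \<le> l) b))}"
  proof (rule set_eqI)
    fix b
    have "cnt b l + Suc k = l \<longleftrightarrow> cnt b l = a" by (auto simp: l_def)
    then show "b \<in> first_tight N s n l k \<longleftrightarrow> b \<in> {b \<in> words N s. cnt b l = a \<and>
        P (filter (\<lambda>x. x \<le> l) b) \<and>
        ballot (n - l) 0 (map (\<lambda>x. x - l) (filter (\<lambda>x. \<not> x \<le> l) b))}"
      using high[of b] by (auto simp: first_tight_def P_def cnt_filter_low)
  qed
  \<comment> \<open>The bound at index \<open>a + k\<close> forces all \<open>a\<close> low entries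
    to be at most \<open>a + k\<close>, so the value \<open>l\<close> itself does not occur.\<close>
  moreover have "{x \<in> words a l. P x} = {x \<in> words a (a + k). ballot (a + k) k x}"
  proof (intro equalityI subsetI)
    fix x assume x: "x \<in> {x \<in> words a l. P x}"
    then have "a + k \<le> cnt x (a + k) + k" and len: "length x = a"
      by (auto simp: P_def words_def l_def)
    then have "length (filter (\<lambda>z. z \<le> a + k) x) = length x"
      using cnt_le_length[of x "a + k"] by (simp add: cnt_def)
    then have "\<forall>z\<in>set x. z \<le> a + k"
      by (metis length_filter_less nat_less_le)
    then show "x \<in> {x \<in> words a (a + k). ballot (a + k) k x}"
      using x by (auto simp: words_def P_def ballot_def l_def)
  qed (fastforce simp: words_def P_def ballot_def l_def)
  ultimately show ?thesis
    using card_words_split[of l s a N P "ballot (n - l) 0"] assms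
    by (simp add: num_flaw_0[of "a + k" "a + k" a k] flip: l_def)
qed

lemma first_tight_eq_empty: "l \<le> k \<Longrightarrow> first_tight N s n l k = {}"
  by (auto simp: first_tight_def)

section \<open>Convolution at the first maximal deficit\<close>

lemma num_flaw_convolution:
  "num_flaw a (a + Suc k) (a + Suc k) 0 =
    (\<Sum>b\<le>a. (a choose b) * num_flaw b (b + k) (b + k) 0 * num_flaw (a - b) (a - b) (a - b) 0)"
proof -
  define m where "m = a + Suc k"
  let ?H = "\<lambda>b. first_tight a m m (Suc (b + k)) k"
  have "{as \<in> words a m. ballot m (Suc k) as} = (\<Union>b\<in>{..a}. ?H b)" (is "?A = ?B")
  proof (intro equalityI subsetI)
    fix as assume as: "as \<in> ?A"
    let ?T = "\<lambda>j. j = cnt as j + Suc k"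
    define j where "j = (LEAST j. ?T j)"
    \<comment> \<open>All \<open>a\<close> entries are counted at \<open>m = a + Suc k\<close>, so
      the full deficit is attained at least there.\<close>
    have "?T m"
      using as cnt_eq_length[of as m m] by (auto simp: words_def m_def)
    then have j: "?T j" "j \<le> m"
      unfolding j_def by (fact LeastI[of ?T m], fact Least_le[of ?T m])
    have min: "\<not> ?T i" if "i < j" for i
      using that not_less_Least[of i ?T] unfolding j_def by blast
    have le: "i \<le> cnt as i + Suc k" if "i \<le> m" for i
      using as that by (auto simp: ballot_def)
    \<comment> \<open>This is \<open>cnt as j\<close>, the number of entries up to the first index
      with full deficit.\<close>
    define b where "b = j - Suc k"
    have b: "j = Suc (b + k)" "b \<le> a"
      using j by (auto simp: b_def m_def)
    have "i \<le> cnt as i + k" if "i < j" for i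
      using le[of i] min[OF that] that j(2) by simp
    then have "as \<in> ?H b"
      using as j(1) le unfolding first_tight_def b(1)[symmetric] by auto
    with b(2) show "as \<in> ?B" by blast
  next
    fix as assume "as \<in> ?B"
    then obtain b where b: "b \<le> a" "as \<in> ?H b" by auto
    let ?l = "Suc (b + k)"
    have "j \<le> cnt as j + Suc k" if "j \<le> m" for j
    proof -
      consider "j < ?l" | "j = ?l" | "?l < j" by linarith
      then show ?thesis
      proof cases
        case 1
        then have "j \<le> cnt as j + k" using b(2) by (auto simp: first_tight_def)
        then show ?thesis by simp
      qed (use b(2) that in \<open>auto simp: first_tight_def\<close>)
    qed
    then show "as \<in> ?A"
      using b(2) by (auto simp: first_tight_def ballot_def)
  qed
  moreover have "?H b \<inter> ?H c = {}" if "b \<noteq> c" for b c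
  proof -
    \<comment> \<open>The full deficit at the smaller index breaks the stricter bound required
      before the larger one.\<close>
    have "as \<notin> ?H c" if "b < c" "as \<in> ?H b" for as b c
    proof
      assume "as \<in> ?H c"
      then have "Suc (b + k) \<le> cnt as (Suc (b + k)) + k"
        using \<open>b < c\<close> by (simp add: first_tight_def)
      then show False
        using \<open>as \<in> ?H b\<close> by (simp add: first_tight_def)
    qed
    then show ?thesis using that by (metis disjoint_iff linorder_neqE_nat)
  qed
  ultimately have "num_flaw a m m 0 = (\<Sum>b\<le>a. card (?H b))"
    using num_flaw_0[of m m a "Suc k"]
    by (simp add: m_def card_UN_disjoint first_tight_def)
  also have "\<dots> = (\<Sum>b\<le>a. (a choose b) * num_flaw b (b + k) (b + k) 0 *
      num_flaw (a - b) (a - b) (a - b) 0)"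
  proof (rule sum.cong[OF refl])
    fix b assume "b \<in> {..a}"
    then show "card (?H b) = (a choose b) * num_flaw b (b + k) (b + k) 0 *
        num_flaw (a - b) (a - b) (a - b) 0"
      using card_first_tight[of b k m a m] num_flaw_0[of "a - b" "a - b" "a - b" 0]
      by (simp add: m_def)
  qed
  finally show ?thesis by (simp add: m_def)
qed

section \<open>Closed formulas for differences in the first entry\<close>

lemma ballot_0_cong:
  assumes "c \<in> words L t" "t \<le> m" "m \<le> L"
  shows "ballot m 0 c \<longleftrightarrow> ballot L 0 c"
proof -
  have "j \<le> cnt c j" if "t \<le> j" "j \<le> L" for j
    using assms(1) that cnt_eq_length[of c t j] by (auto simp: words_def)
  then show ?thesis
    using assms unfolding ballot_def by (metis add_0_right dual_order.trans nat_le_linear)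
qed

text \<open>The high part has \<open>n - 1 - a\<close> cars but is tested only up to
  \<open>n - Suc (a + k)\<close>. Its entries are at most \<open>s - Suc (a + k)\<close>, so all
  cars are counted from there on and the remaining tests hold automatically.\<close>

lemma card_first_tight_num_flaw:
  assumes "Suc (a + k) \<le> s" "s \<le> n"
  shows "card (first_tight (n - 1) s n (Suc (a + k)) k) =
    ((n - 1) choose a) * num_flaw a (a + k) (a + k) 0 *
    num_flaw (n - 1 - a) (n - 1 - a) (s - Suc (a + k)) 0"
proof -
  have "{y \<in> words (n - 1 - a) (s - Suc (a + k)). ballot (n - Suc (a + k)) 0 y} =
      {y \<in> words (n - 1 - a) (s - Suc (a + k)). ballot (n - 1 - a) 0 y}"
    using assms ballot_0_cong[of _ "n - 1 - a" "s - Suc (a + k)" "n - Suc (a + k)"] by auto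
  then show ?thesis
    using card_first_tight[of a k s "n - 1" n] assms
      num_flaw_0[of "s - Suc (a + k)" "n - 1 - a" "n - 1 - a" 0] by simp
qed

text \<open>Below \<open>t\<close> a first entry 1 helps as much as one allowed failure does behind
  a first entry \<open>t\<close>; from \<open>t\<close> on both conditions are automatic. Hence both
  have the same tails, and the difference leaves those that park entirely behind
  \<open>t\<close>.\<close>

lemma num_flaw_first_1_diff:
  assumes "1 \<le> t" "t \<le> L"
  shows "int (num_flaw_first 1 (Suc L) (Suc L) t 0) - int (num_flaw_first t (Suc L) (Suc L) t 1) =
    int (num_flaw L L t 0)"
proof -
  have full: "cnt c j = L" if "c \<in> words L t" "t \<le> j" for c j
    using that cnt_eq_length[of c t j] by (auto simp: words_def)
  have "ballot (Suc L) 0 (1 # c) \<longleftrightarrow> ballot (Suc L) 1 (t # c)" if "c \<in> words L t" for c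
  proof -
    have "j \<le> cnt (1 # c) j + 0 \<longleftrightarrow> j \<le> cnt (t # c) j + 1" if "j \<le> Suc L" for j
      using full[OF \<open>c \<in> words L t\<close>, of j] assms that by (cases "j = 0") (auto simp: not_le)
    then show ?thesis unfolding ballot_def by blast
  qed
  then have 1: "ballot_tails (Suc L) t 1 0 = ballot_tails (Suc L) t t 1"
    by (auto simp: ballot_tails_def)
  have "ballot (Suc L) 0 (t # c) \<longleftrightarrow> ballot L 0 c" if c: "c \<in> words L t" for c
  proof -
    have "j \<le> cnt (t # c) j \<longleftrightarrow> (j \<le> L \<longrightarrow> j \<le> cnt c j)" if "j \<le> Suc L" for j
      using full[OF c, of j] assms that by (cases "t \<le> j") auto
    then show ?thesis unfolding ballot_def by (metis add_0_right le_SucI)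
  qed
  then have "ballot_tails (Suc L) t t 0 = {c \<in> words L t. ballot L 0 c}"
    by (auto simp: ballot_tails_def)
  then show ?thesis
    using num_flaw_first_0[of 1 t "Suc L"] num_flaw_first_Suc[of t t "Suc L" 0]
      num_flaw_0[of t L L 0] assms 1 by simp
qed

lemma num_flaw_first_diff_0:
  assumes "1 \<le> r" "r < t" "t \<le> N"
  shows "int (num_flaw_first (Suc r) N N t 0) - int (num_flaw_first r N N t 0) =
    - int (((N - 1) choose (r - 1)) * num_flaw (r - 1) (r - 1) (r - 1) 0 *
      num_flaw (N - r) (N - r) (t - r) 0)"
  using card_first_tight_num_flaw[of "r - 1" 0 t N] card_ballot_tails_diff[of r N t 0]
    num_flaw_first_0[of "Suc r" t N] num_flaw_first_0[of r t N] assms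
  by simp

section \<open>The recurrence in the first preference\<close>

theorem theorem6p6:
  fixes n s k l :: nat
  assumes "1 \<le> k" and "k \<le> l" and "l + 1 \<le> s" and "s \<le> n"
  shows "int (num_flaw_first (l + 1) n n s k) - int (num_flaw_first l n n s k) =
    (\<Sum>i \<in> {k - 1..<l - 1}.
        int ((n - 1) choose (i + 1 - k)) * int (num_flaw (i + 1 - k) i i 0) *
        (int (num_flaw_first (l - i) (n + k - i - 1) (n + k - i - 1) (s - i - 1) 0)
         - int (num_flaw_first (l - i - 1) (n + k - i - 1) (n + k - i - 1) (s - i - 1) 0)))
    + int ((n - 1) choose (l - k)) * int (num_flaw (l - k) (l - 1) (l - 1) 0) *
        (int (num_flaw_first 1 (n + k - l) (n + k - l) (s - l) 0)
         - int (num_flaw_first (s - l) (n + k - l) (n + k - l) (s - l) 1))"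
proof -
  \<comment> \<open>With \<open>k = h + 1\<close> and \<open>l = a + h + 1\<close>, so
    \<open>a = l - k\<close>, most truncated subtractions become sums.\<close>
  obtain h where h: "k = Suc h"
    using assms(1) by (cases k) auto
  obtain a where l: "l = Suc (a + h)"
    using assms(2) h by (metis add.commute le_Suc_ex add_Suc)
  have sn: "Suc (Suc (a + h)) \<le> s" "s \<le> n"
    using assms l by auto
  let ?H = "\<lambda>k. int (card (first_tight (n - 1) s n l k))"
  let ?q = "num_flaw (n - a) (n - a) (s - l) 0"
  \<comment> \<open>Exactly \<open>k\<close> failures means at most \<open>k\<close> but not at most
    \<open>h\<close>, so the tight sets for both bounds appear, with opposite signs.\<close>
  have lhs: "int (num_flaw_first (l + 1) n n s k) - int (num_flaw_first l n n s k) = ?H h - ?H k"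
    using num_flaw_first_Suc[of "Suc l" s n h] num_flaw_first_Suc[of l s n h]
      card_ballot_tails_diff[of l n s k] card_ballot_tails_diff[of l n s h] sn
    by (simp add: h l)
  have last: "?H h = int ((n - 1) choose (l - k)) * int (num_flaw (l - k) (l - 1) (l - 1) 0) *
        (int (num_flaw_first 1 (n + k - l) (n + k - l) (s - l) 0)
         - int (num_flaw_first (s - l) (n + k - l) (n + k - l) (s - l) 1))"
  proof -
    have "n + k - l = Suc (n - 1 - a)"
      using sn by (simp add: h l)
    then show ?thesis
      using card_first_tight_num_flaw[of a h s n] num_flaw_first_1_diff[of "s - l" "n - 1 - a"] sn
      by (simp add: h l)
  qed
  have "?H k = int (\<Sum>b<a. ((n - 1) choose b) * num_flaw b (b + h) (b + h) 0 *
      (((n - b - 1) choose (a - b - 1)) * num_flaw (a - b - 1) (a - b - 1) (a - b - 1) 0 * ?q))"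
  proof (cases a)
    \<comment> \<open>Here \<open>l = k\<close>: a deficit of \<open>Suc k\<close> is impossible at
      \<open>l\<close>, and the sum is empty.\<close>
    case 0
    then show ?thesis by (simp add: h l first_tight_eq_empty)
  next
    case (Suc c)
    have "card (first_tight (n - 1) s n l k) =
        ((n - 1) choose c) * num_flaw c (c + Suc h) (c + Suc h) 0 * ?q"
      using card_first_tight_num_flaw[of c k s n] sn by (simp add: h l Suc)
    also have "\<dots> = (\<Sum>b\<le>c. ((n - 1) choose c) * (c choose b) *
        (num_flaw b (b + h) (b + h) 0 * num_flaw (c - b) (c - b) (c - b) 0 * ?q))"
      by (simp only: num_flaw_convolution sum_distrib_left sum_distrib_right mult_ac)
    \<comment> \<open>Choosing \<open>c\<close> positions and then \<open>b\<close> among them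
      equals choosing the \<open>b\<close> first; this separates the factor that depends only on the
      outer index.\<close>
    also have "\<dots> = (\<Sum>b\<le>c. ((n - 1) choose b) * ((n - 1 - b) choose (c - b)) *
        (num_flaw b (b + h) (b + h) 0 * num_flaw (c - b) (c - b) (c - b) 0 * ?q))"
      using choose_mult[of _ c "n - 1"] sn by (intro sum.cong) (auto simp: Suc)
    also have "\<dots> = (\<Sum>b<a. ((n - 1) choose b) * num_flaw b (b + h) (b + h) 0 *
      (((n - b - 1) choose (a - b - 1)) * num_flaw (a - b - 1) (a - b - 1) (a - b - 1) 0 * ?q))"
      by (intro sum.cong) (auto simp: Suc less_Suc_eq_le mult_ac)
    finally show ?thesis by simp
  qed
  also have "\<dots> = - (\<Sum>b<a. int ((n - 1) choose b) * int (num_flaw b (b + h) (b + h) 0) *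
      (int (num_flaw_first (Suc (a - b)) (n - b) (n - b) (s - (b + h) - 1) 0)
       - int (num_flaw_first (a - b) (n - b) (n - b) (s - (b + h) - 1) 0)))"
    unfolding of_nat_sum sum_negf[symmetric]
  proof (intro sum.cong refl)
    fix b assume b: "b \<in> {..<a}"
    then have "n - b - (a - b) = n - a" "s - (b + h) - 1 - (a - b) = s - l"
      using sn by (auto simp: l)
    \<comment> \<open>With first entry \<open>a - b\<close> and \<open>n - b\<close> cars, the
      difference formula yields the same last factor \<open>?q\<close> for every
      \<open>b\<close>.\<close>
    then have diff: "int (num_flaw_first (Suc (a - b)) (n - b) (n - b) (s - (b + h) - 1) 0)
        - int (num_flaw_first (a - b) (n - b) (n - b) (s - (b + h) - 1) 0) =
        - int (((n - b - 1) choose (a - b - 1)) * num_flaw (a - b - 1) (a - b - 1) (a - b - 1) 0 * ?q)"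
      using num_flaw_first_diff_0[of "a - b" "s - (b + h) - 1" "n - b"] b sn by auto
    show "int (((n - 1) choose b) * num_flaw b (b + h) (b + h) 0 *
        (((n - b - 1) choose (a - b - 1)) * num_flaw (a - b - 1) (a - b - 1) (a - b - 1) 0 * ?q)) =
        - (int ((n - 1) choose b) * int (num_flaw b (b + h) (b + h) 0) *
        (int (num_flaw_first (Suc (a - b)) (n - b) (n - b) (s - (b + h) - 1) 0)
         - int (num_flaw_first (a - b) (n - b) (n - b) (s - (b + h) - 1) 0)))"
      unfolding diff by simp
  qed
  also have "(\<Sum>b<a. int ((n - 1) choose b) * int (num_flaw b (b + h) (b + h) 0) *
      (int (num_flaw_first (Suc (a - b)) (n - b) (n - b) (s - (b + h) - 1) 0)
       - int (num_flaw_first (a - b) (n - b) (n - b) (s - (b + h) - 1) 0))) =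
    (\<Sum>i \<in> {k - 1..<l - 1}.
        int ((n - 1) choose (i + 1 - k)) * int (num_flaw (i + 1 - k) i i 0) *
        (int (num_flaw_first (l - i) (n + k - i - 1) (n + k - i - 1) (s - i - 1) 0)
         - int (num_flaw_first (l - i - 1) (n + k - i - 1) (n + k - i - 1) (s - i - 1) 0)))"
    \<comment> \<open>The index of the claim is \<open>i = b + h\<close>, running from
      \<open>k - 1\<close> to \<open>l - 2\<close>.\<close>
    by (rule sum.reindex_bij_witness[of _ "\<lambda>i. i - h" "\<lambda>b. b + h"])
      (auto simp: h l Suc_diff_le)
  finally show ?thesis
    using lhs last by linarith
qed

end
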